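(* Let $H_1,H_2$ be separable Hilbert spaces and, for $i=1,2$, let $\mathcal{S}_i$ be a commutative lattice (not necessarily complete) of projections on $H_i$ containing zero and the identity. Let $\theta:\mathcal{S}_1\to\mathcal{S}_2$ be a lattice isomorphism. Then $\theta$ extends to a $*$-isomorphism $\rho:\mathrm{span}(\mathcal{S}_1)^{-\|\cdot\|}\to\mathrm{span}(\mathcal{S}_2)^{-\|\cdot\|}$.
   Context: Here a commutative, not necessarily complete, lattice of projections is a set of pairwise commuting orthogonal projections closed under finite suprema $\vee$ and infima $\wedge$. A lattice isomorphism is an order isomorphism (a bijection preserving order in both directions). $\mathrm{span}(\mathcal{S})^{-\|\cdot\|}$ is the operator-norm closure of the linear span of $\mathcal{S}$ (a commutative $C^*$-algebra). *)

theory Defs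
  imports "HOL-Analysis.Analysis"
begin

section \<open>Complex Hilbert spaces\<close>

class complex_vector = real_vector +
  fixes scaleC :: "complex \<Rightarrow> 'a \<Rightarrow> 'a" (infixr \<open>*\<^sub>C\<close> 75)
  assumes scaleC_add_right: "a *\<^sub>C (x + y) = a *\<^sub>C x + a *\<^sub>C y"
    and scaleC_add_left: "(a + b) *\<^sub>C x = a *\<^sub>C x + b *\<^sub>C x"
    and scaleC_scaleC: "a *\<^sub>C b *\<^sub>C x = (a * b) *\<^sub>C x"
    and scaleC_one: "1 *\<^sub>C x = x"
    and scaleR_scaleC: "r *\<^sub>R x = complex_of_real r *\<^sub>C x"

global_interpretation complex_vector:
  vector_space "scaleC :: complex \<Rightarrow> 'a \<Rightarrow> 'a::complex_vector"
  by standard (simp_all add: scaleC_add_right scaleC_add_left scaleC_scaleC scaleC_one)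

abbreviation csubspace :: "'a::complex_vector set \<Rightarrow> bool"
  where "csubspace \<equiv> module.subspace scaleC"

abbreviation cspan :: "'a::complex_vector set \<Rightarrow> 'a set"
  where "cspan \<equiv> module.span scaleC"

abbreviation clinear :: "('a::complex_vector \<Rightarrow> 'b::complex_vector) \<Rightarrow> bool"
  where "clinear \<equiv> Vector_Spaces.linear scaleC scaleC"

class complex_normed_vector = complex_vector + real_normed_vector +
  assumes norm_scaleC: "norm (a *\<^sub>C x) = cmod a * norm x"

text \<open>The inner product is linear in the first and conjugate-linear in the second argument.\<close>

class complex_inner = complex_normed_vector +
  fixes cinner :: "'a \<Rightarrow> 'a \<Rightarrow> complex"
  assumes cinner_commute: "cinner x y = cnj (cinner y x)"
    and cinner_add_left: "cinner (x + y) z = cinner x z + cinner y z"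
    and cinner_scaleC_left: "cinner (a *\<^sub>C x) y = a * cinner x y"
    and norm_eq_sqrt_cinner: "norm x = sqrt (Re (cinner x x))"

class chilbert_space = complex_inner + banach

section \<open>Bounded operators\<close>

text \<open>
  The bounded operators on a complex Hilbert space are the elements \<open>T\<close> of the library type
  \<open>'a \<Rightarrow>\<^sub>L 'a\<close> of bounded real-linear maps (normed by the operator norm) with \<open>clinear T\<close>.
  Complex multiples are taken pointwise.
\<close>

lemma bounded_linear_scaleC_right:
  "bounded_linear ((*\<^sub>C) c :: 'a \<Rightarrow> 'a::complex_normed_vector)"
proof (rule bounded_linear_intro)
  show "c *\<^sub>C (x + y) = c *\<^sub>C x + c *\<^sub>C y" for x y :: 'a
    by (rule scaleC_add_right)
  show "c *\<^sub>C r *\<^sub>R x = r *\<^sub>R c *\<^sub>C x" for r and x :: 'a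
    by (simp add: scaleR_scaleC scaleC_scaleC mult.commute)
  show "norm (c *\<^sub>C x) \<le> norm x * cmod c" for x :: 'a
    by (simp add: norm_scaleC mult.commute)
qed

instantiation blinfun :: (real_normed_vector, complex_normed_vector) complex_normed_vector
begin

lift_definition scaleC_blinfun :: "complex \<Rightarrow> 'a \<Rightarrow>\<^sub>L 'b \<Rightarrow> 'a \<Rightarrow>\<^sub>L 'b"
  is "\<lambda>c f x. c *\<^sub>C f x"
  by (rule bounded_linear_compose[OF bounded_linear_scaleC_right])

instance
proof
  fix a b :: complex and r :: real and f g :: "'a \<Rightarrow>\<^sub>L 'b"
  show "a *\<^sub>C (f + g) = a *\<^sub>C f + a *\<^sub>C g"
    by transfer (simp add: scaleC_add_right)
  show "(a + b) *\<^sub>C f = a *\<^sub>C f + b *\<^sub>C f"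
    by transfer (simp add: scaleC_add_left)
  show "a *\<^sub>C b *\<^sub>C f = (a * b) *\<^sub>C f"
    by transfer (simp add: scaleC_scaleC)
  show "1 *\<^sub>C f = f"
    by transfer (simp add: scaleC_one)
  show "r *\<^sub>R f = complex_of_real r *\<^sub>C f"
    by transfer (simp add: scaleR_scaleC)
  have le: "norm (c *\<^sub>C h) \<le> cmod c * norm h" for c and h :: "'a \<Rightarrow>\<^sub>L 'b"
  proof (rule norm_blinfun_bound)
    show "norm ((c *\<^sub>C h) x) \<le> cmod c * norm h * norm x" for x
      using mult_left_mono[OF norm_blinfun[of h x], of "cmod c"]
      by (simp add: scaleC_blinfun.rep_eq norm_scaleC mult.assoc)
  qed simp
  show "norm (a *\<^sub>C f) = cmod a * norm f"
  proof (cases "a = 0")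
    case True
    with le[of 0 f] show ?thesis by simp
  next
    case False
    have "f = inverse a *\<^sub>C a *\<^sub>C f"
      using False by transfer (simp add: scaleC_scaleC scaleC_one)
    with le[of "inverse a" "a *\<^sub>C f"] have "norm f \<le> inverse (cmod a) * norm (a *\<^sub>C f)"
      by (simp add: norm_inverse)
    with False have "cmod a * norm f \<le> norm (a *\<^sub>C f)"
      by (simp add: field_simps)
    with le[of a f] show ?thesis by simp
  qed
qed

end

definition is_adjoint ::
    "('a::complex_inner \<Rightarrow>\<^sub>L 'b::complex_inner) \<Rightarrow> ('b \<Rightarrow>\<^sub>L 'a) \<Rightarrow> bool"
  where "is_adjoint T T' \<longleftrightarrow> (\<forall>x y. cinner (T x) y = cinner x (T' y))"

text \<open>
  On Hilbert spaces the adjoint exists for every complex-linear \<open>T\<close> (Riesz), and it is unique.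
\<close>

definition cadjoint :: "('a::complex_inner \<Rightarrow>\<^sub>L 'b::complex_inner) \<Rightarrow> ('b \<Rightarrow>\<^sub>L 'a)"
  where "cadjoint T = (THE T'. is_adjoint T T')"

section \<open>Lattices of projections\<close>

definition is_projection :: "('a::complex_inner \<Rightarrow>\<^sub>L 'a) \<Rightarrow> bool"
  where "is_projection P \<longleftrightarrow> clinear P \<and> P o\<^sub>L P = P \<and> is_adjoint P P"

definition proj_le :: "('a::complex_inner \<Rightarrow>\<^sub>L 'a) \<Rightarrow> ('a \<Rightarrow>\<^sub>L 'a) \<Rightarrow> bool"
  where "proj_le P Q \<longleftrightarrow> range P \<subseteq> range Q"

text \<open>
  An orthogonal projection is determined by its range: \<open>P \<and> Q\<close> is the projection onto the
  intersection of the ranges, \<open>P \<or> Q\<close> the projection onto the closed linear span of their union.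
\<close>

definition is_proj_inf ::
    "('a::complex_inner \<Rightarrow>\<^sub>L 'a) \<Rightarrow> ('a \<Rightarrow>\<^sub>L 'a) \<Rightarrow> ('a \<Rightarrow>\<^sub>L 'a) \<Rightarrow> bool"
  where "is_proj_inf P Q R \<longleftrightarrow> is_projection R \<and> range R = range P \<inter> range Q"

definition is_proj_sup ::
    "('a::complex_inner \<Rightarrow>\<^sub>L 'a) \<Rightarrow> ('a \<Rightarrow>\<^sub>L 'a) \<Rightarrow> ('a \<Rightarrow>\<^sub>L 'a) \<Rightarrow> bool"
  where "is_proj_sup P Q R \<longleftrightarrow>
    is_projection R \<and> range R = closure (cspan (range P \<union> range Q))"

definition commutative_projection_lattice :: "('a::complex_inner \<Rightarrow>\<^sub>L 'a) set \<Rightarrow> bool"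
  where "commutative_projection_lattice \<S> \<longleftrightarrow>
    (\<forall>P\<in>\<S>. is_projection P) \<and>
    (\<forall>P\<in>\<S>. \<forall>Q\<in>\<S>. P o\<^sub>L Q = Q o\<^sub>L P) \<and>
    (\<forall>P\<in>\<S>. \<forall>Q\<in>\<S>. \<exists>R\<in>\<S>. is_proj_inf P Q R) \<and>
    (\<forall>P\<in>\<S>. \<forall>Q\<in>\<S>. \<exists>R\<in>\<S>. is_proj_sup P Q R)"

definition lattice_isomorphism ::
    "('a::complex_inner \<Rightarrow>\<^sub>L 'a) set \<Rightarrow> ('b::complex_inner \<Rightarrow>\<^sub>L 'b) set \<Rightarrow>
      (('a \<Rightarrow>\<^sub>L 'a) \<Rightarrow> ('b \<Rightarrow>\<^sub>L 'b)) \<Rightarrow> bool"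
  where "lattice_isomorphism \<S>\<^sub>1 \<S>\<^sub>2 \<theta> \<longleftrightarrow>
    bij_betw \<theta> \<S>\<^sub>1 \<S>\<^sub>2 \<and>
    (\<forall>P\<in>\<S>\<^sub>1. \<forall>Q\<in>\<S>\<^sub>1. proj_le P Q \<longleftrightarrow> proj_le (\<theta> P) (\<theta> Q))"

section \<open>Operator algebras\<close>

definition cstar_algebra :: "('a::complex_inner \<Rightarrow>\<^sub>L 'a) set \<Rightarrow> bool"
  where "cstar_algebra \<A> \<longleftrightarrow>
    (\<forall>T\<in>\<A>. clinear T) \<and> csubspace \<A> \<and> closed \<A> \<and>
    (\<forall>S\<in>\<A>. \<forall>T\<in>\<A>. S o\<^sub>L T \<in> \<A>) \<and>
    (\<forall>T\<in>\<A>. cadjoint T \<in> \<A>)"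

definition star_isomorphism ::
    "('a::complex_inner \<Rightarrow>\<^sub>L 'a) set \<Rightarrow> ('b::complex_inner \<Rightarrow>\<^sub>L 'b) set \<Rightarrow>
      (('a \<Rightarrow>\<^sub>L 'a) \<Rightarrow> ('b \<Rightarrow>\<^sub>L 'b)) \<Rightarrow> bool"
  where "star_isomorphism \<A> \<B> \<rho> \<longleftrightarrow>
    cstar_algebra \<A> \<and> cstar_algebra \<B> \<and>
    bij_betw \<rho> \<A> \<B> \<and>
    (\<forall>S\<in>\<A>. \<forall>T\<in>\<A>. \<rho> (S + T) = \<rho> S + \<rho> T) \<and>
    (\<forall>c. \<forall>T\<in>\<A>. \<rho> (c *\<^sub>C T) = c *\<^sub>C \<rho> T) \<and>
    (\<forall>S\<in>\<A>. \<forall>T\<in>\<A>. \<rho> (S o\<^sub>L T) = \<rho> S o\<^sub>L \<rho> T) \<and>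
    (\<forall>T\<in>\<A>. \<rho> (cadjoint T) = cadjoint (\<rho> T))"

end

theory Submission
  imports Defs
begin

text \<open>
  The graph \<open>G\<close> of the linear extension consists of the pairs
  \<open>(\<Sum> c\<^sub>i P\<^sub>i, \<Sum> c\<^sub>i \<theta> P\<^sub>i)\<close>.  Both entries have the same norm: splitting a vector successively along
  \<open>P\<^sub>i\<close> and \<open>1 - P\<^sub>i\<close> decomposes it into orthogonal pieces in the ranges of projections
  \<open>A (1 - B)\<close> with \<open>A\<close>, \<open>B\<close> in the lattice, on which the operator is a scalar, and \<open>A (1 - B)\<close> vanishes
  iff \<open>A \<le> B\<close>, a property that \<open>\<theta>\<close> preserves.  Hence the norm closure of \<open>G\<close> is again the
  graph of an isometry, and it inherits compatibility with products and adjoints from \<open>G\<close>.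
\<close>

section \<open>Inner products and adjoints\<close>

lemma cinner_add_right: "cinner x (y + z) = cinner x y + cinner x z"
  by (metis cinner_add_left cinner_commute complex_cnj_add)

lemma cinner_scaleC_right: "cinner x (a *\<^sub>C y) = cnj a * cinner x y"
  by (metis cinner_commute cinner_scaleC_left complex_cnj_mult)

lemma scaleC_minus_one: "(-1) *\<^sub>C x = - (x :: 'a::complex_vector)"
  using scaleR_scaleC[of "-1" x] by simp

lemma cinner_minus_left: "cinner (- x) y = - cinner x y"
  by (metis cinner_scaleC_left scaleC_minus_one mult_minus1)

lemma cinner_minus_right: "cinner x (- y) = - cinner x y"
  by (metis cinner_commute cinner_minus_left complex_cnj_minus)

lemma cinner_diff_left: "cinner (x - y) z = cinner x z - cinner y z"
  using cinner_add_left[of x "- y" z] by (simp add: cinner_minus_left)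

lemma cinner_diff_right: "cinner x (y - z) = cinner x y - cinner x z"
  using cinner_add_right[of x y "- z"] by (simp add: cinner_minus_right)

lemma Re_cinner_self: "Re (cinner x x) = (norm x)\<^sup>2"
  by (metis norm_eq_sqrt_cinner norm_ge_zero real_sqrt_ge_0_iff real_sqrt_pow2)

lemma norm_add_sq: "(norm (x + y))\<^sup>2 = (norm x)\<^sup>2 + 2 * Re (cinner x y) + (norm y)\<^sup>2"
  for x y :: "'a::complex_inner"
proof -
  have "Re (cinner y x) = Re (cinner x y)"
    by (metis cinner_commute complex_cnj(1) cnj.sel(1))
  then show ?thesis
    by (simp add: Re_cinner_self[symmetric] cinner_add_left cinner_add_right)
qed

text \<open>The real part of Cauchy-Schwarz is read off from the triangle inequality, which the
  normed space axioms already supply.\<close>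

lemma Re_cinner_le: "Re (cinner x y) \<le> norm x * norm y"
proof -
  have "(norm (x + y))\<^sup>2 \<le> (norm x + norm y)\<^sup>2"
    by (intro power_mono norm_triangle_ineq norm_ge_zero)
  then show ?thesis
    unfolding norm_add_sq by (simp add: power2_sum)
qed

lemma norm_cinner_le: "cmod (cinner x y) \<le> norm x * norm y"
proof (cases "cinner x y = 0")
  case False
  \<comment> \<open>\<open>u\<close> is the phase that rotates \<open>cinner x y\<close> onto the
    positive real axis, so the bound on real parts applies to \<open>u *\<^sub>C x\<close> and
    \<open>y\<close>.\<close>
  define u where "u = cnj (cinner x y) / cmod (cinner x y)"
  have "u * cinner x y = cmod (cinner x y)"
    using False complex_norm_square[of "cinner x y"]
    by (simp add: u_def power2_eq_square field_simps)
  moreover have "cmod u = 1"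
    using False by (simp add: u_def norm_divide)
  ultimately show ?thesis
    using Re_cinner_le[of "u *\<^sub>C x" y] by (simp add: cinner_scaleC_left norm_scaleC)
qed simp

lemma bounded_bilinear_cinner: "bounded_bilinear (cinner :: 'a::complex_inner \<Rightarrow> 'a \<Rightarrow> complex)"
proof
  show "\<exists>K. \<forall>x y :: 'a. cmod (cinner x y) \<le> norm x * norm y * K"
    by (intro exI[of _ 1]) (simp add: norm_cinner_le)
qed (simp_all add: cinner_add_left cinner_add_right scaleR_scaleC cinner_scaleC_left
  cinner_scaleC_right scaleR_conv_of_real)

lemma cinner_ext:
  assumes "\<And>z. cinner x z = cinner y z"
  shows "x = y"
proof -
  have "cinner (x - y) (x - y) = 0"
    using assms by (simp add: cinner_diff_left)
  then show ?thesis
    by (metis Re_cinner_self zero_complex.sel(1) eq_iff_diff_eq_0 norm_eq_zero power_eq_0_iff)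
qed

section \<open>Adjoint pairs of bounded operators: uniqueness, norms, algebra and limits\<close>

lemma is_adjoint_sym: "is_adjoint T T' \<Longrightarrow> is_adjoint T' T"
  unfolding is_adjoint_def by (metis cinner_commute)

lemma is_adjoint_unique:
  assumes "is_adjoint T T'" "is_adjoint T T''"
  shows "T' = T''"
  using assms is_adjoint_sym unfolding is_adjoint_def
  by (intro blinfun_eqI cinner_ext) (metis cinner_commute)

lemma cadjoint_eqI: "is_adjoint T T' \<Longrightarrow> cadjoint T = T'"
  unfolding cadjoint_def by (blast intro: is_adjoint_unique)

text \<open>\<open>(norm (T' y))\<^sup>2\<close> is the real part of
  \<open>cinner (T (T' y)) y\<close>; after Cauchy-Schwarz one factor \<open>norm (T' y)\<close>
  cancels. Later this makes the adjoints of a convergent sequence Cauchy.\<close>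

lemma is_adjoint_norm_le:
  assumes "is_adjoint T T'"
  shows "norm T' \<le> norm T"
proof (rule norm_blinfun_bound)
  fix y
  have "(norm (T' y))\<^sup>2 = Re (cinner (T (T' y)) y)"
    using assms by (simp add: is_adjoint_def Re_cinner_self)
  also have "\<dots> \<le> norm (T (T' y)) * norm y"
    by (rule Re_cinner_le)
  also have "\<dots> \<le> norm T * norm (T' y) * norm y"
    by (intro mult_right_mono norm_blinfun norm_ge_zero)
  finally have "norm (T' y) * norm (T' y) \<le> norm (T' y) * (norm T * norm y)"
    by (simp add: power2_eq_square ac_simps)
  then show "norm (T' y) \<le> norm T * norm y"
    by (cases "T' y = 0") auto
qed simp

lemma is_adjoint_zero: "is_adjoint 0 0"
  by (simp add: is_adjoint_def bounded_bilinear.zero_left[OF bounded_bilinear_cinner]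
      bounded_bilinear.zero_right[OF bounded_bilinear_cinner])

lemma is_adjoint_add:
  "is_adjoint S S' \<Longrightarrow> is_adjoint T T' \<Longrightarrow> is_adjoint (S + T) (S' + T')"
  by (simp add: is_adjoint_def blinfun.add_left cinner_add_left cinner_add_right)

lemma is_adjoint_diff:
  "is_adjoint S S' \<Longrightarrow> is_adjoint T T' \<Longrightarrow> is_adjoint (S - T) (S' - T')"
  by (simp add: is_adjoint_def blinfun.diff_left cinner_diff_left cinner_diff_right)

lemma is_adjoint_scaleC: "is_adjoint T T' \<Longrightarrow> is_adjoint (c *\<^sub>C T) (cnj c *\<^sub>C T')"
  by (simp add: is_adjoint_def scaleC_blinfun.rep_eq cinner_scaleC_left cinner_scaleC_right)

lemma is_adjoint_compose:
  "is_adjoint S S' \<Longrightarrow> is_adjoint T T' \<Longrightarrow> is_adjoint (S o\<^sub>L T) (T' o\<^sub>L S')"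
  by (simp add: is_adjoint_def)

lemma is_adjoint_lim:
  assumes "X \<longlonglongrightarrow> T" "Y \<longlonglongrightarrow> T'" "\<And>n. is_adjoint (X n) (Y n)"
  shows "is_adjoint T T'"
  unfolding is_adjoint_def
proof (intro allI)
  fix x y
  have "(\<lambda>n. cinner (X n x) y) \<longlonglongrightarrow> cinner (T x) y"
    by (intro bounded_bilinear.tendsto[OF bounded_bilinear_cinner] blinfun.tendsto assms(1)
      tendsto_const)
  moreover have "(\<lambda>n. cinner x (Y n y)) \<longlonglongrightarrow> cinner x (T' y)"
    by (intro bounded_bilinear.tendsto[OF bounded_bilinear_cinner] blinfun.tendsto assms(2)
      tendsto_const)
  moreover have "cinner (X n x) y = cinner x (Y n y)" for n
    using assms(3) by (simp add: is_adjoint_def)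
  ultimately show "cinner (T x) y = cinner x (T' y)"
    by (simp add: LIMSEQ_unique)
qed

lemma clinear_blinfun_iff:
  fixes T :: "'a::complex_normed_vector \<Rightarrow>\<^sub>L 'b::complex_normed_vector"
  shows "clinear T \<longleftrightarrow> (\<forall>c x. T (c *\<^sub>C x) = c *\<^sub>C T x)"
  by (auto simp: Vector_Spaces.linear_def module_hom_def module_hom_axioms_def
      complex_vector.module_axioms complex_vector.vector_space_axioms blinfun.add_right)

lemma Cauchy_if_dist_le:
  assumes "Cauchy X" "\<And>m n. dist (Y m) (Y n) \<le> dist (X m) (X n)"
  shows "Cauchy Y"
  using assms unfolding Cauchy_def by (meson le_less_trans)

section \<open>Commuting projections\<close>

lemma projection_idem: "is_projection P \<Longrightarrow> P (P x) = P x"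
  unfolding is_projection_def by (metis blinfun_apply_blinfun_compose)

lemma projection_range_iff: "is_projection P \<Longrightarrow> x \<in> range P \<longleftrightarrow> P x = x"
  by (metis projection_idem rangeE rangeI)

lemma projection_scaleC: "is_projection P \<Longrightarrow> P (c *\<^sub>C x) = c *\<^sub>C P x"
  by (simp add: is_projection_def clinear_blinfun_iff)

lemma projection_cinner: "is_projection P \<Longrightarrow> cinner (P x) y = cinner x (P y)"
  by (simp add: is_projection_def is_adjoint_def)

lemma is_projectionI:
  fixes P :: "'a::complex_inner \<Rightarrow>\<^sub>L 'a"
  assumes "\<And>c x. P (c *\<^sub>C x) = c *\<^sub>C P x" "\<And>x. P (P x) = P x" "is_adjoint P P"
  shows "is_projection P"
  using assms by (auto simp: is_projection_def clinear_blinfun_iff intro: blinfun_eqI)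

text \<open>Each projection fixes the range of the other, so self-adjointness gives
  \<open><Px,z> = <QPx,z> = <Px,Qz> = <x,PQz> = <x,Qz> = <Qx,z>\<close>.\<close>

lemma projection_eqI:
  assumes P: "is_projection P" and Q: "is_projection Q" and r: "range P = range Q"
  shows "P = Q"
proof (rule blinfun_eqI, rule cinner_ext)
  fix x z
  have "Q (P x) = P x" "P (Q z) = Q z"
    using r projection_range_iff[OF P] projection_range_iff[OF Q] by blast+
  then show "cinner (P x) z = cinner (Q x) z"
    by (metis projection_cinner[OF P] projection_cinner[OF Q])
qed

lemma projection_range_closed:
  assumes "is_projection P"
  shows "closed (range P)"
proof -
  have "range P = {x. P x = x}"
    using projection_range_iff[OF assms] by auto
  then show ?thesis
    by (simp add: closed_Collect_eq blinfun.continuous_on)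
qed

lemma projection_range_csubspace:
  assumes "is_projection P"
  shows "csubspace (range P)"
proof -
  have "range P = {x. P x = x}"
    using projection_range_iff[OF assms] by auto
  then show ?thesis
    by (simp add: complex_vector.subspace_def blinfun.add_right projection_scaleC[OF assms])
qed

section \<open>Meets and joins of commuting projections as algebraic expressions\<close>

lemma commute_apply: "P o\<^sub>L Q = Q o\<^sub>L P \<Longrightarrow> P (Q x) = Q (P x)"
  by (metis blinfun_apply_blinfun_compose)

text \<open>For commuting projections this is \<open>1 - (1 - P)(1 - Q)\<close>, their supremum,
  written without any closed span.\<close>

definition proj_join :: "('a::complex_inner \<Rightarrow>\<^sub>L 'a) \<Rightarrow> ('a \<Rightarrow>\<^sub>L 'a) \<Rightarrow> ('a \<Rightarrow>\<^sub>L 'a)"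
  where "proj_join P Q = P + Q - (P o\<^sub>L Q)"

lemma proj_join_apply: "proj_join P Q x = P x + Q x - P (Q x)"
  by (simp add: proj_join_def blinfun.add_left blinfun.diff_left)

context
  fixes P Q :: "'a::complex_inner \<Rightarrow>\<^sub>L 'a"
  assumes P: "is_projection P" and Q: "is_projection Q" and PQ: "P o\<^sub>L Q = Q o\<^sub>L P"
begin

lemma is_projection_compose: "is_projection (P o\<^sub>L Q)"
proof (rule is_projectionI)
  show "is_adjoint (P o\<^sub>L Q) (P o\<^sub>L Q)"
    using P Q PQ is_adjoint_compose[of P P Q Q] by (simp add: is_projection_def)
qed (simp_all add: projection_scaleC[OF P] projection_scaleC[OF Q]
  commute_apply[OF PQ, symmetric] projection_idem[OF P] projection_idem[OF Q])

lemma is_projection_proj_join: "is_projection (proj_join P Q)"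
proof (rule is_projectionI)
  show "is_adjoint (proj_join P Q) (proj_join P Q)"
    using P Q is_projection_compose unfolding proj_join_def
    by (auto simp: is_projection_def intro: is_adjoint_add is_adjoint_diff)
  show "proj_join P Q (c *\<^sub>C x) = c *\<^sub>C proj_join P Q x" for c x
    by (simp add: proj_join_apply projection_scaleC[OF P] projection_scaleC[OF Q]
        complex_vector.scale_right_diff_distrib scaleC_add_right)
  show "proj_join P Q (proj_join P Q x) = proj_join P Q x" for x
    by (simp add: proj_join_apply projection_idem[OF P] projection_idem[OF Q]
        blinfun.add_right blinfun.diff_right commute_apply[OF PQ, symmetric])
qed

text \<open>The product of commuting projections is a projection onto the intersection of the
  ranges, and a projection is determined by its range. Order-theoretic meets thus become
  products.\<close>

lemma is_proj_inf_iff: "is_proj_inf P Q R \<longleftrightarrow> R = P o\<^sub>L Q"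
proof -
  have "range (P o\<^sub>L Q) = range P \<inter> range Q"
  proof
    show "range (P o\<^sub>L Q) \<subseteq> range P \<inter> range Q"
    proof
      fix y assume "y \<in> range (P o\<^sub>L Q)"
      then obtain x where "y = P (Q x)"
        by auto
      then show "y \<in> range P \<inter> range Q"
        using commute_apply[OF PQ] by blast
    qed
    show "range P \<inter> range Q \<subseteq> range (P o\<^sub>L Q)"
      unfolding projection_range_iff[OF is_projection_compose] subset_iff Int_iff
        projection_range_iff[OF P] projection_range_iff[OF Q] by auto
  qed
  then show ?thesis
    unfolding is_proj_inf_def using is_projection_compose projection_eqI by metis
qed

text \<open>Values of the join are combinations of vectors from the two ranges; conversely, its
  range is a closed subspace containing both. The two inclusions identify it with the closed
  span.\<close>

lemma is_proj_sup_iff: "is_proj_sup P Q R \<longleftrightarrow> R = proj_join P Q"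
proof -
  have "range (proj_join P Q) = closure (cspan (range P \<union> range Q))"
  proof
    have "proj_join P Q x \<in> cspan (range P \<union> range Q)" for x
      unfolding proj_join_apply
      by (intro complex_vector.span_diff complex_vector.span_add complex_vector.span_base) auto
    then show "range (proj_join P Q) \<subseteq> closure (cspan (range P \<union> range Q))"
      using closure_subset by blast
    \<comment> \<open>If \<open>P x = x\<close>, then \<open>P (Q x) = Q x\<close> by commutation,
      and these two terms cancel in \<open>proj_join P Q x\<close>; if \<open>Q x = x\<close>, then
      \<open>P x\<close> and \<open>P (Q x)\<close> cancel.\<close>
    have "range P \<union> range Q \<subseteq> range (proj_join P Q)"
      using commute_apply[OF PQ] unfolding projection_range_iff[OF is_projection_proj_join]
        subset_iff Un_iff projection_range_iff[OF P] projection_range_iff[OF Q]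
      by (metis add.commute add_diff_cancel_left' proj_join_apply)
    then have "cspan (range P \<union> range Q) \<subseteq> range (proj_join P Q)"
      by (intro complex_vector.span_minimal projection_range_csubspace is_projection_proj_join)
    then show "closure (cspan (range P \<union> range Q)) \<subseteq> range (proj_join P Q)"
      by (intro closure_minimal projection_range_closed is_projection_proj_join)
  qed
  then show ?thesis
    unfolding is_proj_sup_def using is_projection_proj_join projection_eqI by metis
qed

end

section \<open>The graph of the linear extension\<close>

text \<open>A relation rather than a function: an operator may be a linear combination of
  projections in several ways, and independence of the choice is only a consequence of the norm
  identity. Adding one term at a time provides the induction.\<close>

inductive_set extension_graph ::
    "('a::complex_inner \<Rightarrow>\<^sub>L 'a) set \<Rightarrow> (('a \<Rightarrow>\<^sub>L 'a) \<Rightarrow> ('b::complex_inner \<Rightarrow>\<^sub>L 'b)) \<Rightarrow>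
      (('a \<Rightarrow>\<^sub>L 'a) \<times> ('b \<Rightarrow>\<^sub>L 'b)) set"
  for \<S> \<theta> where
    zero: "(0, 0) \<in> extension_graph \<S> \<theta>"
  | step: "(T, U) \<in> extension_graph \<S> \<theta> \<Longrightarrow> P \<in> \<S> \<Longrightarrow>
      (T + c *\<^sub>C P, U + c *\<^sub>C \<theta> P) \<in> extension_graph \<S> \<theta>"

lemma extension_graph_base: "P \<in> \<S> \<Longrightarrow> (P, \<theta> P) \<in> extension_graph \<S> \<theta>"
  using extension_graph.step[OF extension_graph.zero, where c = 1] by (simp add: scaleC_one)

lemma extension_graph_add:
  assumes "(T, U) \<in> extension_graph \<S> \<theta>" "(T', U') \<in> extension_graph \<S> \<theta>"
  shows "(T + T', U + U') \<in> extension_graph \<S> \<theta>"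
  using assms(2)
proof induction
  case (step T' U' P c)
  then show ?case
    using extension_graph.step[of "T + T'" "U + U'" \<S> \<theta> P c] by (simp add: add.assoc)
qed (simp add: assms(1))

lemma extension_graph_scaleC:
  assumes "(T, U) \<in> extension_graph \<S> \<theta>"
  shows "(c *\<^sub>C T, c *\<^sub>C U) \<in> extension_graph \<S> \<theta>"
  using assms
proof induction
  case (step T U P d)
  then show ?case
    using extension_graph.step[of "c *\<^sub>C T" "c *\<^sub>C U" \<S> \<theta> P "c * d"]
    by (simp add: scaleC_add_right scaleC_scaleC)
qed (simp add: extension_graph.zero)

lemma extension_graph_diff:
  assumes "(T, U) \<in> extension_graph \<S> \<theta>" "(T', U') \<in> extension_graph \<S> \<theta>"
  shows "(T - T', U - U') \<in> extension_graph \<S> \<theta>"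
  using extension_graph_add[OF assms(1) extension_graph_scaleC[OF assms(2), of "-1"]]
  by (simp add: scaleC_minus_one)

text \<open>Lets every estimate in one direction be reused for the inverse of
  \<open>\<theta>\<close>.\<close>

lemma extension_graph_converse:
  assumes "(T, U) \<in> extension_graph \<S> \<theta>" "\<And>P. P \<in> \<S> \<Longrightarrow> \<theta>' (\<theta> P) = P"
  shows "(U, T) \<in> extension_graph (\<theta> ` \<S>) \<theta>'"
  using assms(1)
proof induction
  case (step T U P c)
  then show ?case
    using extension_graph.step[of U T "\<theta> ` \<S>" \<theta>' "\<theta> P" c] assms(2) by simp
qed (rule extension_graph.zero)

lemma fst_extension_graph: "fst ` extension_graph \<S> \<theta> = cspan \<S>"
proof
  have "T \<in> cspan \<S>" if "(T, U) \<in> extension_graph \<S> \<theta>" for T U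
    using that
    by induction (auto intro: complex_vector.span_zero complex_vector.span_add
        complex_vector.span_scale complex_vector.span_base)
  then show "fst ` extension_graph \<S> \<theta> \<subseteq> cspan \<S>"
    by auto
  show "cspan \<S> \<subseteq> fst ` extension_graph \<S> \<theta>"
  proof (rule complex_vector.span_minimal)
    show "\<S> \<subseteq> fst ` extension_graph \<S> \<theta>"
      by (force dest: extension_graph_base[of _ _ \<theta>])
    have mem: "T \<in> fst ` extension_graph \<S> \<theta> \<longleftrightarrow> (\<exists>U. (T, U) \<in> extension_graph \<S> \<theta>)" for T
      by force
    show "csubspace (fst ` extension_graph \<S> \<theta>)"
      unfolding complex_vector.subspace_def Ball_def mem
      by (blast intro: extension_graph_add extension_graph_scaleC extension_graph.zero)
  qed
qed

text \<open>The order is replaced by algebraic identities for meets and joins. The target lattice is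
  the image of \<open>\<S>\<close> under \<open>\<theta>\<close>, so that the inverse map satisfies
  the same assumptions.\<close>

locale projection_embedding =
  fixes \<S> :: "('a::chilbert_space \<Rightarrow>\<^sub>L 'a) set"
    and \<theta> :: "('a \<Rightarrow>\<^sub>L 'a) \<Rightarrow> ('b::chilbert_space \<Rightarrow>\<^sub>L 'b)"
  assumes proj: "P \<in> \<S> \<Longrightarrow> is_projection P"
    and proj_image: "P \<in> \<S> \<Longrightarrow> is_projection (\<theta> P)"
    and commute: "P \<in> \<S> \<Longrightarrow> Q \<in> \<S> \<Longrightarrow> P o\<^sub>L Q = Q o\<^sub>L P"
    and meet: "P \<in> \<S> \<Longrightarrow> Q \<in> \<S> \<Longrightarrow> P o\<^sub>L Q \<in> \<S>"
    and join: "P \<in> \<S> \<Longrightarrow> Q \<in> \<S> \<Longrightarrow> proj_join P Q \<in> \<S>"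
    and zero: "0 \<in> \<S>"
    and one: "id_blinfun \<in> \<S>"
    and theta_meet: "P \<in> \<S> \<Longrightarrow> Q \<in> \<S> \<Longrightarrow> \<theta> (P o\<^sub>L Q) = \<theta> P o\<^sub>L \<theta> Q"
    and theta_join: "P \<in> \<S> \<Longrightarrow> Q \<in> \<S> \<Longrightarrow> \<theta> (proj_join P Q) = proj_join (\<theta> P) (\<theta> Q)"
    and theta_zero: "\<theta> 0 = 0"
    and theta_one: "\<theta> id_blinfun = id_blinfun"
    and theta_inj: "inj_on \<theta> \<S>"
begin

section \<open>The extension is isometric and multiplicative on the linear span\<close>

abbreviation "G \<equiv> extension_graph \<S> \<theta>"

lemma commute_image: "P \<in> \<S> \<Longrightarrow> Q \<in> \<S> \<Longrightarrow> \<theta> P o\<^sub>L \<theta> Q = \<theta> Q o\<^sub>L \<theta> P"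
  by (metis theta_meet commute)

lemma graph_commute:
  assumes "(T, U) \<in> G" "P \<in> \<S>"
  shows "P (T x) = T (P x)"
  using assms(1)
proof induction
  case (step T U Q c)
  then show ?case
    using commute_apply[OF commute[OF assms(2) step(2)]]
    by (simp add: blinfun.add_left blinfun.add_right scaleC_blinfun.rep_eq
        projection_scaleC[OF proj[OF assms(2)]])
qed simp

text \<open>The norm bound \<open>M\<close> is transferred from the target piece
  \<open>\<theta> A (1 - \<theta> B)\<close> to the piece \<open>A (1 - B)\<close>. The scalar
  \<open>a\<close> collects the coefficients of the terms already split off. It varies with
  \<open>A\<close> and \<open>B\<close> in the induction: a new term \<open>c *\<^sub>C P\<close>
  leads to the pieces with \<open>A P\<close>, \<open>B\<close>, \<open>a + c\<close> and with
  \<open>A\<close>, \<open>proj_join B P\<close>, \<open>a\<close>.\<close>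

lemma graph_norm_le_on_piece:
  assumes "(T, U) \<in> G" "A \<in> \<S>" "B \<in> \<S>" "0 \<le> M"
    and "\<And>y. \<theta> A y = y \<Longrightarrow> \<theta> B y = 0 \<Longrightarrow> norm (a *\<^sub>C y + U y) \<le> M * norm y"
    and "A x = x" "B x = 0"
  shows "norm (a *\<^sub>C x + T x) \<le> M * norm x"
  using assms(1-3,5-)
proof (induction arbitrary: A B a x)
  case zero
  show ?case
  proof (cases "x = 0")
    case False
    \<comment> \<open>A nonzero vector of the piece witnesses that \<open>A o\<^sub>L B\<close>
      differs from \<open>A\<close>; injectivity and preservation of meets carry this over to the
      images.\<close>
    have "A (B x) \<noteq> A x"
      using zero False by simp
    then have "A o\<^sub>L B \<noteq> A"
      by (metis blinfun_apply_blinfun_compose)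
    then have "\<theta> A o\<^sub>L \<theta> B \<noteq> \<theta> A"
      using zero theta_inj meet theta_meet by (metis inj_onD)
    then obtain z where z: "\<theta> A (\<theta> B z) \<noteq> \<theta> A z"
      by (metis blinfun_apply_blinfun_compose blinfun_eqI)
    \<comment> \<open>This \<open>y\<close> is a nonzero vector of the target piece, and the
      hypothesis at \<open>y\<close> forces \<open>cmod a \<le> M\<close>.\<close>
    define y where "y = \<theta> A z - \<theta> A (\<theta> B z)"
    note pA = projection_idem[OF proj_image[OF zero(1)]]
    note pB = projection_idem[OF proj_image[OF zero(2)]]
    note com = commute_apply[OF commute_image[OF zero(1,2)]]
    have "\<theta> A y = y" "\<theta> B y = 0"
      by (simp_all add: y_def blinfun.diff_right pA pB com[symmetric])
    then have "norm (a *\<^sub>C y) \<le> M * norm y"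
      using zero(3)[of y] by simp
    moreover have "y \<noteq> 0"
      using z by (simp add: y_def)
    ultimately have "cmod a \<le> M"
      by (simp add: norm_scaleC)
    then show ?thesis
      by (simp add: norm_scaleC mult_right_mono)
  qed simp
next
  case (step T U P c)
  note P = step(2) and A = step(4) and B = step(5) and hyp = step(6)
  note pP = proj[OF P]
  \<comment> \<open>Both parts of \<open>x\<close> stay in the piece of \<open>A\<close> and
    \<open>B\<close>, because \<open>P\<close> commutes with both.\<close>
  define x1 where "x1 = P x"
  define x2 where "x2 = x - P x"
  have P12: "P x1 = x1" "P x2 = 0"
    by (simp_all add: x1_def x2_def blinfun.diff_right projection_idem[OF pP])
  have AB: "A x1 = x1" "B x1 = 0" "A x2 = x2" "B x2 = 0"
    using step(7,8) commute_apply[OF commute[OF A P]] commute_apply[OF commute[OF B P]]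
    by (simp_all add: x1_def x2_def blinfun.diff_right)
  \<comment> \<open>\<open>P\<close> is the identity on \<open>x1\<close> and zero on
    \<open>x2\<close>, so \<open>c\<close> joins the scalar on the first part and disappears on the
    second.\<close>
  define w1 where "w1 = (a + c) *\<^sub>C x1 + T x1"
  define w2 where "w2 = a *\<^sub>C x2 + T x2"
  have "norm w1 \<le> M * norm x1"
    unfolding w1_def
  proof (rule step.IH[OF meet[OF A P] B])
    fix y assume y: "\<theta> (A o\<^sub>L P) y = y" "\<theta> B y = 0"
    then have *: "\<theta> A (\<theta> P y) = y"
      by (simp add: theta_meet[OF A P])
    have "\<theta> A y = y"
      using projection_idem[OF proj_image[OF A], of "\<theta> P y"] * by simp
    moreover have "\<theta> P y = y"
      using projection_idem[OF proj_image[OF P], of "\<theta> A y"]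
        commute_apply[OF commute_image[OF A P]] * by simp
    ultimately show "norm ((a + c) *\<^sub>C y + U y) \<le> M * norm y"
      using hyp[of y] y
      by (simp add: blinfun.add_left scaleC_blinfun.rep_eq scaleC_add_left ac_simps)
  qed (simp_all add: AB P12)
  moreover have "norm w2 \<le> M * norm x2"
    unfolding w2_def
  proof (rule step.IH[OF A join[OF B P]])
    fix y assume y: "\<theta> A y = y" "\<theta> (proj_join B P) y = 0"
    then have *: "\<theta> B y + \<theta> P y - \<theta> B (\<theta> P y) = 0"
      by (simp add: theta_join[OF B P] proj_join_apply)
    \<comment> \<open>Applying \<open>\<theta> B\<close> to the vanishing join leaves
      \<open>\<theta> B y\<close>, and applying \<open>\<theta> P\<close> leaves
      \<open>\<theta> P y\<close>, so both are zero.\<close>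
    have "\<theta> B (\<theta> B y + \<theta> P y - \<theta> B (\<theta> P y)) = 0" "\<theta> P (\<theta> B y + \<theta> P y - \<theta> B (\<theta> P y)) = 0"
      unfolding * by simp_all
    then have "\<theta> B y = 0" "\<theta> P y = 0"
      by (simp_all add: blinfun.diff_right blinfun.add_right
          projection_idem[OF proj_image[OF B]] projection_idem[OF proj_image[OF P]]
          commute_apply[OF commute_image[OF B P]])
    then show "norm (a *\<^sub>C y + U y) \<le> M * norm y"
      using hyp[of y] y by (simp add: blinfun.add_left scaleC_blinfun.rep_eq)
  qed (simp_all add: AB P12 proj_join_apply)
  ultimately have "(norm w1)\<^sup>2 + (norm w2)\<^sup>2 \<le> (M * norm x1)\<^sup>2 + (M * norm x2)\<^sup>2"
    by (intro add_mono power_mono norm_ge_zero)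
  \<comment> \<open>Such \<open>u\<close> and \<open>v\<close> are orthogonal, since
    \<open>cinner (P u) v = cinner u (P v) = 0\<close>.\<close>
  moreover have pyth: "(norm (u + v))\<^sup>2 = (norm u)\<^sup>2 + (norm v)\<^sup>2" if "P u = u" "P v = 0" for u v
    using that projection_cinner[OF pP, of u v]
    by (simp add: norm_add_sq bounded_bilinear.zero_right[OF bounded_bilinear_cinner])
  have "P w1 = w1" "P w2 = 0"
    using graph_commute[OF step(1) P] P12
    by (simp_all add: w1_def w2_def blinfun.add_right projection_scaleC[OF pP])
  then have "(norm (w1 + w2))\<^sup>2 = (norm w1)\<^sup>2 + (norm w2)\<^sup>2"
    by (rule pyth)
  moreover have "(norm x)\<^sup>2 = (norm x1)\<^sup>2 + (norm x2)\<^sup>2"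
    using pyth[OF P12] by (simp add: x1_def x2_def)
  ultimately have "(norm (w1 + w2))\<^sup>2 \<le> (M * norm x)\<^sup>2"
    by (simp add: power_mult_distrib distrib_left)
  then have "norm (w1 + w2) \<le> M * norm x"
    by (rule power2_le_imp_le) (simp add: assms(4))
  moreover have "w1 + w2 = a *\<^sub>C x + (T + c *\<^sub>C P) x"
    by (simp add: w1_def w2_def x1_def x2_def blinfun.add_left blinfun.diff_right
        scaleC_blinfun.rep_eq scaleC_add_left complex_vector.scale_right_diff_distrib)
  ultimately show ?case
    by simp
qed

text \<open>The whole space is the piece with \<open>A = id_blinfun\<close> and
  \<open>B = 0\<close>; start with scalar \<open>0\<close> and bound \<open>norm U\<close>.\<close>

lemma graph_norm_le:
  assumes "(T, U) \<in> G"
  shows "norm T \<le> norm U"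
proof (rule norm_blinfun_bound)
  show "norm (T x) \<le> norm U * norm x" for x
    using graph_norm_le_on_piece[OF assms one zero, of "norm U" 0 x]
    by (simp add: norm_blinfun)
qed simp

text \<open>The assumptions are symmetric under passing to the inverse, which supplies the reverse
  norm inequality and the description of the second components.\<close>

lemma projection_embedding_inv: "projection_embedding (\<theta> ` \<S>) (inv_into \<S> \<theta>)"
proof -
  note [simp] = inv_into_f_f[OF theta_inj]
  have inv: "inv_into \<S> \<theta> 0 = 0" "inv_into \<S> \<theta> id_blinfun = id_blinfun"
    using inv_into_f_f[OF theta_inj] zero one theta_zero theta_one by metis+
  have "0 \<in> \<theta> ` \<S>" "id_blinfun \<in> \<theta> ` \<S>"
    using zero one theta_zero theta_one by (metis imageI)+
  then show ?thesis
    by unfold_locales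
      (auto simp: inv proj proj_image commute_image meet join theta_meet[symmetric]
        theta_join[symmetric] intro: inj_on_inv_into)
qed

lemma inv_graph_iff: "(U, T) \<in> extension_graph (\<theta> ` \<S>) (inv_into \<S> \<theta>) \<longleftrightarrow> (T, U) \<in> G"
proof
  assume "(U, T) \<in> extension_graph (\<theta> ` \<S>) (inv_into \<S> \<theta>)"
  then have "(T, U) \<in> extension_graph (inv_into \<S> \<theta> ` \<theta> ` \<S>) \<theta>"
    by (rule extension_graph_converse) (rule f_inv_into_f)
  then show "(T, U) \<in> G"
    using theta_inj by (simp add: inv_into_image_cancel)
next
  assume "(T, U) \<in> G"
  then show "(U, T) \<in> extension_graph (\<theta> ` \<S>) (inv_into \<S> \<theta>)"
    using theta_inj by (intro extension_graph_converse) auto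
qed

lemma graph_norm:
  assumes "(T, U) \<in> G"
  shows "norm T = norm U"
proof (rule antisym)
  interpret inv: projection_embedding "\<theta> ` \<S>" "inv_into \<S> \<theta>"
    by (rule projection_embedding_inv)
  show "norm U \<le> norm T"
    using assms by (intro inv.graph_norm_le) (simp add: inv_graph_iff)
qed (rule graph_norm_le[OF assms])

text \<open>By bilinearity it suffices to multiply two projections, where \<open>meet\<close> and
  \<open>theta_meet\<close> apply. The right factor is expanded first, then the left one.\<close>

lemma graph_compose:
  assumes "(T, U) \<in> G" "(T', U') \<in> G"
  shows "(T o\<^sub>L T', U o\<^sub>L U') \<in> G"
proof -
  have base: "(P o\<^sub>L T', \<theta> P o\<^sub>L U') \<in> G" if P: "P \<in> \<S>" for P
    using assms(2)
  proof induction
    case (step T' U' Q c)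
    \<comment> \<open>Elements of the operator type are only real-linear, so pulling
      \<open>c\<close> out of the right factor uses that \<open>R\<close> is a projection.\<close>
    have eq: "R o\<^sub>L (S + c *\<^sub>C Q) = (R o\<^sub>L S) + c *\<^sub>C (R o\<^sub>L Q)" if "is_projection R"
      for R S Q :: "'c::complex_inner \<Rightarrow>\<^sub>L 'c"
      by (rule blinfun_eqI)
        (simp add: blinfun.add_left blinfun.add_right scaleC_blinfun.rep_eq
          projection_scaleC[OF that])
    show ?case
      using extension_graph.step[OF step.IH meet[OF P step(2)], of c]
      by (simp add: eq proj proj_image P theta_meet[OF P step(2)])
  qed (simp add: extension_graph.zero)
  show ?thesis
    using assms(1)
  proof induction
    case (step T U P c)
    have eq: "(S + c *\<^sub>C R) o\<^sub>L Q = (S o\<^sub>L Q) + c *\<^sub>C (R o\<^sub>L Q)"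
      for R S Q :: "'c::complex_inner \<Rightarrow>\<^sub>L 'c"
      by (rule blinfun_eqI) (simp add: blinfun.add_left scaleC_blinfun.rep_eq)
    show ?case
      unfolding eq by (intro extension_graph_add step extension_graph_scaleC base)
  qed (simp add: extension_graph.zero)
qed

text \<open>Projections are self-adjoint, so conjugating the coefficients yields explicit adjoints
  on both sides.\<close>

lemma graph_adjoint:
  assumes "(T, U) \<in> G"
  shows "\<exists>T' U'. (T', U') \<in> G \<and> is_adjoint T T' \<and> is_adjoint U U'"
  using assms
proof induction
  case zero
  show ?case
    by (intro exI[of _ 0] conjI extension_graph.zero is_adjoint_zero)
next
  case (step T U P c)
  then obtain T' U' where "(T', U') \<in> G" "is_adjoint T T'" "is_adjoint U U'"
    by blast
  moreover have "is_adjoint P P" "is_adjoint (\<theta> P) (\<theta> P)"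
    using proj[OF step(2)] proj_image[OF step(2)] by (simp_all add: is_projection_def)
  ultimately show ?case
    by (intro exI[of _ "T' + cnj c *\<^sub>C P"] exI[of _ "U' + cnj c *\<^sub>C \<theta> P"] conjI
        extension_graph.step step(2) is_adjoint_add is_adjoint_scaleC)
qed

section \<open>The closure of the graph\<close>

lemma closure_graph_sequence:
  assumes "(T, U) \<in> closure G"
  obtains X Y where "\<And>n. (X n, Y n) \<in> G" "X \<longlonglongrightarrow> T" "Y \<longlonglongrightarrow> U"
proof -
  obtain Z where "\<And>n. Z n \<in> G" "Z \<longlonglongrightarrow> (T, U)"
    using assms unfolding closure_sequential by blast
  then show thesis
    using that[of "fst \<circ> Z" "snd \<circ> Z"] tendsto_fst[of Z "(T, U)"] tendsto_snd[of Z "(T, U)"]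
    by (simp add: comp_def)
qed

lemma closure_graphI:
  assumes "\<And>n. (X n, Y n) \<in> G" "X \<longlonglongrightarrow> T" "Y \<longlonglongrightarrow> U"
  shows "(T, U) \<in> closure G"
  unfolding closure_sequential
  using assms tendsto_Pair[OF assms(2,3)] by (intro exI[of _ "\<lambda>n. (X n, Y n)"]) auto

lemma closure_graph_add:
  assumes "(T, U) \<in> closure G" "(T', U') \<in> closure G"
  shows "(T + T', U + U') \<in> closure G"
proof -
  obtain X Y X' Y' where "\<And>n. (X n, Y n) \<in> G" "X \<longlonglongrightarrow> T" "Y \<longlonglongrightarrow> U"
    "\<And>n. (X' n, Y' n) \<in> G" "X' \<longlonglongrightarrow> T'" "Y' \<longlonglongrightarrow> U'"
    using assms by (metis closure_graph_sequence)
  then show ?thesis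
    by (intro closure_graphI[of "\<lambda>n. X n + X' n" "\<lambda>n. Y n + Y' n"] extension_graph_add tendsto_add)
qed

lemma closure_graph_scaleC:
  assumes "(T, U) \<in> closure G"
  shows "(c *\<^sub>C T, c *\<^sub>C U) \<in> closure G"
proof -
  obtain X Y where "\<And>n. (X n, Y n) \<in> G" "X \<longlonglongrightarrow> T" "Y \<longlonglongrightarrow> U"
    using assms by (metis closure_graph_sequence)
  then show ?thesis
    by (intro closure_graphI[of "\<lambda>n. c *\<^sub>C X n" "\<lambda>n. c *\<^sub>C Y n"] extension_graph_scaleC
        bounded_linear.tendsto[OF bounded_linear_scaleC_right])
qed

lemma closure_graph_diff:
  assumes "(T, U) \<in> closure G" "(T', U') \<in> closure G"
  shows "(T - T', U - U') \<in> closure G"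
  using closure_graph_add[OF assms(1) closure_graph_scaleC[OF assms(2), of "-1"]]
  by (simp add: scaleC_minus_one)

lemma closure_graph_compose:
  assumes "(T, U) \<in> closure G" "(T', U') \<in> closure G"
  shows "(T o\<^sub>L T', U o\<^sub>L U') \<in> closure G"
proof -
  obtain X Y X' Y' where "\<And>n. (X n, Y n) \<in> G" "X \<longlonglongrightarrow> T" "Y \<longlonglongrightarrow> U"
    "\<And>n. (X' n, Y' n) \<in> G" "X' \<longlonglongrightarrow> T'" "Y' \<longlonglongrightarrow> U'"
    using assms by (metis closure_graph_sequence)
  then show ?thesis
    by (intro closure_graphI[of "\<lambda>n. X n o\<^sub>L X' n" "\<lambda>n. Y n o\<^sub>L Y' n"] graph_compose
        bounded_bilinear.tendsto[OF bounded_bilinear_blinfun_compose])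
qed

lemma closure_graph_norm:
  assumes "(T, U) \<in> closure G"
  shows "norm T = norm U"
proof -
  obtain X Y where XY: "\<And>n. (X n, Y n) \<in> G" "X \<longlonglongrightarrow> T" "Y \<longlonglongrightarrow> U"
    using assms by (metis closure_graph_sequence)
  then have "norm (X n) = norm (Y n)" for n
    by (simp add: graph_norm)
  then show ?thesis
    using tendsto_norm[OF XY(2)] tendsto_norm[OF XY(3)] LIMSEQ_unique by simp
qed

text \<open>Adjoints of the approximants form Cauchy sequences, because taking adjoints does not
  increase norms. Their limits are the adjoints of \<open>T\<close> and \<open>U\<close>, whose
  existence is thereby obtained.\<close>

lemma closure_graph_adjoint:
  assumes "(T, U) \<in> closure G"
  shows "(cadjoint T, cadjoint U) \<in> closure G"
proof -
  obtain X Y where XY: "\<And>n. (X n, Y n) \<in> G" "X \<longlonglongrightarrow> T" "Y \<longlonglongrightarrow> U"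
    using assms by (metis closure_graph_sequence)
  have "\<forall>n. \<exists>T' U'. (T', U') \<in> G \<and> is_adjoint (X n) T' \<and> is_adjoint (Y n) U'"
    using graph_adjoint[OF XY(1)] by blast
  then obtain X' Y' where XY': "\<And>n. (X' n, Y' n) \<in> G"
      "\<And>n. is_adjoint (X n) (X' n)" "\<And>n. is_adjoint (Y n) (Y' n)"
    by metis
  have "dist (X' m) (X' n) \<le> dist (X m) (X n)" "dist (Y' m) (Y' n) \<le> dist (Y m) (Y n)" for m n
    using is_adjoint_norm_le is_adjoint_diff XY'(2,3) unfolding dist_norm by blast+
  then have "Cauchy X'" "Cauchy Y'"
    using Cauchy_if_dist_le LIMSEQ_imp_Cauchy XY(2,3) by blast+
  then obtain T' U' where "X' \<longlonglongrightarrow> T'" "Y' \<longlonglongrightarrow> U'"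
    unfolding Cauchy_convergent_iff convergent_def by blast
  moreover from this have "cadjoint T = T'" "cadjoint U = U'"
    using is_adjoint_lim[OF XY(2) _ XY'(2)] is_adjoint_lim[OF XY(3) _ XY'(3)] cadjoint_eqI
    by blast+
  ultimately show ?thesis
    using XY'(1) by (auto intro: closure_graphI)
qed

lemma closure_graph_clinear:
  assumes "(T, U) \<in> closure G"
  shows "clinear T"
proof -
  have *: "V (c *\<^sub>C x) = c *\<^sub>C V x" if "(V, W) \<in> G" for V W c x
    using that
    by induction (simp_all add: blinfun.add_left scaleC_blinfun.rep_eq projection_scaleC proj
        scaleC_add_right scaleC_scaleC mult.commute)
  obtain X Y where XY: "\<And>n. (X n, Y n) \<in> G" "X \<longlonglongrightarrow> T" "Y \<longlonglongrightarrow> U"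
    using assms by (metis closure_graph_sequence)
  have "T (c *\<^sub>C x) = c *\<^sub>C T x" for c x
  proof (rule LIMSEQ_unique)
    show "(\<lambda>n. X n (c *\<^sub>C x)) \<longlonglongrightarrow> T (c *\<^sub>C x)"
      by (intro blinfun.tendsto XY(2) tendsto_const)
    show "(\<lambda>n. X n (c *\<^sub>C x)) \<longlonglongrightarrow> c *\<^sub>C T x"
      unfolding *[OF XY(1)]
      by (intro bounded_linear.tendsto[OF bounded_linear_scaleC_right] blinfun.tendsto XY(2)
          tendsto_const)
  qed
  then show ?thesis
    by (simp add: clinear_blinfun_iff)
qed

text \<open>Projecting a closure need not give a closed set. Here the graph is isometric, so a
  convergent sequence of first components has a Cauchy sequence of partners, which converges by
  completeness.\<close>

lemma fst_closure_graph: "fst ` closure G = closure (cspan \<S>)"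
proof
  show "fst ` closure G \<subseteq> closure (cspan \<S>)"
  proof clarify
    fix T U assume "(T, U) \<in> closure G"
    then obtain X Y where "\<And>n. (X n, Y n) \<in> G" "X \<longlonglongrightarrow> T" "Y \<longlonglongrightarrow> U"
      by (metis closure_graph_sequence)
    then show "fst (T, U) \<in> closure (cspan \<S>)"
      unfolding closure_sequential fst_extension_graph[of \<S> \<theta>, symmetric] by force
  qed
  show "closure (cspan \<S>) \<subseteq> fst ` closure G"
  proof
    fix T assume "T \<in> closure (cspan \<S>)"
    then obtain X where X: "\<And>n. X n \<in> fst ` G" "X \<longlonglongrightarrow> T"
      unfolding closure_sequential fst_extension_graph[of \<S> \<theta>, symmetric] by blast
    then have "\<forall>n. \<exists>V. (X n, V) \<in> G"
      by force
    then obtain Y where Y: "\<And>n. (X n, Y n) \<in> G"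
      by metis
    have "dist (Y m) (Y n) \<le> dist (X m) (X n)" for m n
      using graph_norm[OF extension_graph_diff[OF Y Y]] by (simp add: dist_norm)
    then have "Cauchy Y"
      using X(2) by (blast intro: Cauchy_if_dist_le LIMSEQ_imp_Cauchy)
    then obtain U where "Y \<longlonglongrightarrow> U"
      unfolding Cauchy_convergent_iff convergent_def by blast
    then have "(T, U) \<in> closure G"
      using X(2) Y by (blast intro: closure_graphI)
    then show "T \<in> fst ` closure G"
      by force
  qed
qed

lemma cstar_algebra_closure_cspan: "cstar_algebra (closure (cspan \<S>))"
proof -
  have mem: "T \<in> closure (cspan \<S>) \<longleftrightarrow> (\<exists>U. (T, U) \<in> closure G)" for T
    unfolding fst_closure_graph[symmetric] by force
  have "(0, 0) \<in> closure G"
    using extension_graph.zero closure_subset by blast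
  then have "csubspace (closure (cspan \<S>))"
    unfolding complex_vector.subspace_def Ball_def mem
    by (blast intro: closure_graph_add closure_graph_scaleC)
  then show ?thesis
    unfolding cstar_algebra_def Ball_def mem
    by (blast intro: closed_closure closure_graph_clinear closure_graph_compose
        closure_graph_adjoint)
qed

text \<open>Swapping components turns this into \<open>fst_closure_graph\<close> for the inverse
  map.\<close>

lemma snd_closure_graph: "snd ` closure G = closure (cspan (\<theta> ` \<S>))"
proof -
  interpret inv: projection_embedding "\<theta> ` \<S>" "inv_into \<S> \<theta>"
    by (rule projection_embedding_inv)
  have "(U, T) \<in> closure inv.G \<longleftrightarrow> (T, U) \<in> closure G" for T U
  proof
    assume "(U, T) \<in> closure inv.G"
    then obtain Y X where "\<And>n. (Y n, X n) \<in> inv.G" "Y \<longlonglongrightarrow> U" "X \<longlonglongrightarrow> T"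
      by (metis inv.closure_graph_sequence)
    then show "(T, U) \<in> closure G"
      unfolding inv_graph_iff by (blast intro: closure_graphI)
  next
    assume "(T, U) \<in> closure G"
    then obtain X Y where "\<And>n. (X n, Y n) \<in> G" "X \<longlonglongrightarrow> T" "Y \<longlonglongrightarrow> U"
      by (metis closure_graph_sequence)
    then show "(U, T) \<in> closure inv.G"
      unfolding inv_graph_iff[symmetric] by (blast intro: inv.closure_graphI)
  qed
  then show ?thesis
    unfolding inv.fst_closure_graph[symmetric] by force
qed

text \<open>The norm identity applied to the difference of the pairs. One direction makes the closed
  graph single-valued, the other makes the resulting map injective.\<close>

lemma closure_graph_fst_eq_iff:
  assumes "(T, U) \<in> closure G" "(T', U') \<in> closure G"
  shows "T = T' \<longleftrightarrow> U = U'"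
  using closure_graph_norm[OF closure_graph_diff[OF assms]] by auto

lemma star_isomorphism_extension:
  "\<exists>\<rho>. star_isomorphism (closure (cspan \<S>)) (closure (cspan (\<theta> ` \<S>))) \<rho> \<and>
    (\<forall>P\<in>\<S>. \<rho> P = \<theta> P)"
proof -
  interpret inv: projection_embedding "\<theta> ` \<S>" "inv_into \<S> \<theta>"
    by (rule projection_embedding_inv)
  let ?A = "fst ` closure G" and ?B = "snd ` closure G"
  have "\<forall>T\<in>?A. \<exists>U. (T, U) \<in> closure G"
    by force
  then obtain \<rho> where rho: "\<And>T. T \<in> ?A \<Longrightarrow> (T, \<rho> T) \<in> closure G"
    by metis
  \<comment> \<open>The chosen value is forced, so every closure property of the graph becomes an
    equation for \<open>\<rho>\<close>.\<close>
  have eq: "\<rho> T = U" if "(T, U) \<in> closure G" for T U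
    using closure_graph_fst_eq_iff[OF rho that] that by (metis fst_conv image_eqI)
  have "bij_betw \<rho> ?A ?B"
  proof (rule bij_betwI')
    show "\<rho> T = \<rho> T' \<longleftrightarrow> T = T'" if "T \<in> ?A" "T' \<in> ?A" for T T'
      using closure_graph_fst_eq_iff[OF rho rho] that by simp
    show "\<rho> T \<in> ?B" if "T \<in> ?A" for T
      using rho[OF that] by force
    show "\<exists>T\<in>?A. U = \<rho> T" if "U \<in> ?B" for U
    proof -
      obtain T where "(T, U) \<in> closure G"
        using \<open>U \<in> ?B\<close> by auto
      then show ?thesis
        using eq by force
    qed
  qed
  moreover have "\<rho> P = \<theta> P" if "P \<in> \<S>" for P
    using extension_graph_base[OF that] closure_subset by (blast intro: eq)
  moreover have "cstar_algebra ?A" "cstar_algebra ?B"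
    using cstar_algebra_closure_cspan inv.cstar_algebra_closure_cspan
    by (simp_all add: fst_closure_graph snd_closure_graph)
  ultimately have "star_isomorphism ?A ?B \<rho> \<and> (\<forall>P\<in>\<S>. \<rho> P = \<theta> P)"
    unfolding star_isomorphism_def
    by (blast intro: eq closure_graph_add closure_graph_scaleC closure_graph_compose
        closure_graph_adjoint rho)
  then show ?thesis
    unfolding fst_closure_graph snd_closure_graph by blast
qed

end

section \<open>Lattice isomorphisms\<close>

lemma commutative_projection_latticeD:
  assumes "commutative_projection_lattice \<S>" "P \<in> \<S>" "Q \<in> \<S>"
  shows "is_projection P" "P o\<^sub>L Q = Q o\<^sub>L P" "P o\<^sub>L Q \<in> \<S>" "proj_join P Q \<in> \<S>"
proof -
  show P: "is_projection P" and PQ: "P o\<^sub>L Q = Q o\<^sub>L P"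
    using assms by (auto simp: commutative_projection_lattice_def)
  have Q: "is_projection Q"
    using assms by (auto simp: commutative_projection_lattice_def)
  show "P o\<^sub>L Q \<in> \<S>" "proj_join P Q \<in> \<S>"
    using assms unfolding commutative_projection_lattice_def
    by (metis is_proj_inf_iff[OF P Q PQ] is_proj_sup_iff[OF P Q PQ])+
qed

lemma proj_le_antisym:
  "is_projection P \<Longrightarrow> is_projection Q \<Longrightarrow> proj_le P Q \<Longrightarrow> proj_le Q P \<Longrightarrow> P = Q"
  by (simp add: proj_le_def projection_eqI)

lemma proj_le_compose_iff:
  assumes "is_projection P" "is_projection Q" "P o\<^sub>L Q = Q o\<^sub>L P"
  shows "proj_le R (P o\<^sub>L Q) \<longleftrightarrow> proj_le R P \<and> proj_le R Q"
  using is_proj_inf_iff[OF assms, of "P o\<^sub>L Q"] by (auto simp: is_proj_inf_def proj_le_def)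

text \<open>The range of \<open>R\<close> is a closed subspace, so it contains the closed span as
  soon as it contains both ranges.\<close>

lemma proj_join_le_iff:
  assumes "is_projection P" "is_projection Q" "P o\<^sub>L Q = Q o\<^sub>L P" "is_projection R"
  shows "proj_le (proj_join P Q) R \<longleftrightarrow> proj_le P R \<and> proj_le Q R"
proof -
  have "range (proj_join P Q) = closure (cspan (range P \<union> range Q))"
    using is_proj_sup_iff[OF assms(1-3), of "proj_join P Q"] by (simp add: is_proj_sup_def)
  moreover have "closure (cspan (range P \<union> range Q)) \<subseteq> range R \<longleftrightarrow> range P \<union> range Q \<subseteq> range R"
    using complex_vector.span_superset[of "range P \<union> range Q"]
      closure_subset[of "cspan (range P \<union> range Q)"]
      closure_minimal[OF complex_vector.span_minimal[OF _ projection_range_csubspace[OF assms(4)]]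
        projection_range_closed[OF assms(4)]]
    by blast
  ultimately show ?thesis
    by (simp add: proj_le_def)
qed

text \<open>Meets, joins, zero and identity are determined by the order, hence preserved by an order
  isomorphism; the inequalities are combined by antisymmetry.\<close>

lemma projection_embedding_if_lattice_isomorphism:
  fixes \<S>\<^sub>1 :: "('a::chilbert_space \<Rightarrow>\<^sub>L 'a) set"
    and \<S>\<^sub>2 :: "('b::chilbert_space \<Rightarrow>\<^sub>L 'b) set"
  assumes S1: "commutative_projection_lattice \<S>\<^sub>1" "0 \<in> \<S>\<^sub>1" "id_blinfun \<in> \<S>\<^sub>1"
    and S2: "commutative_projection_lattice \<S>\<^sub>2" "0 \<in> \<S>\<^sub>2" "id_blinfun \<in> \<S>\<^sub>2"
    and iso: "lattice_isomorphism \<S>\<^sub>1 \<S>\<^sub>2 \<theta>"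
  shows "projection_embedding \<S>\<^sub>1 \<theta>"
proof -
  note d1 = commutative_projection_latticeD[OF S1(1)]
  note d2 = commutative_projection_latticeD[OF S2(1)]
  have bij: "bij_betw \<theta> \<S>\<^sub>1 \<S>\<^sub>2"
    and le: "\<And>P Q. P \<in> \<S>\<^sub>1 \<Longrightarrow> Q \<in> \<S>\<^sub>1 \<Longrightarrow> proj_le (\<theta> P) (\<theta> Q) \<longleftrightarrow> proj_le P Q"
    using iso by (auto simp: lattice_isomorphism_def)
  have mem: "\<theta> P \<in> \<S>\<^sub>2" if "P \<in> \<S>\<^sub>1" for P
    using bij that by (rule bij_betwE[rule_format])
  have surj: "\<exists>P\<in>\<S>\<^sub>1. R = \<theta> P" if "R \<in> \<S>\<^sub>2" for R
    using bij that by (auto simp: bij_betw_def)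
  have eqI: "R = R'" if "R \<in> \<S>\<^sub>2" "R' \<in> \<S>\<^sub>2" "proj_le R R'" "proj_le R' R" for R R'
    using that d2(1) by (blast intro: proj_le_antisym)
  have le_refl: "proj_le P P" for P :: "'c::complex_inner \<Rightarrow>\<^sub>L 'c"
    by (simp add: proj_le_def)
  have le_one: "proj_le P id_blinfun" for P :: "'c::complex_inner \<Rightarrow>\<^sub>L 'c"
    by (auto simp: proj_le_def)
  have zero_le: "proj_le 0 P" for P :: "'c::complex_inner \<Rightarrow>\<^sub>L 'c"
    using blinfun.zero_right[of P] by (auto simp: proj_le_def intro: range_eqI[of _ _ 0])
  show ?thesis
  proof
    \<comment> \<open>The preimage of zero lies above zero, so monotonicity puts
      \<open>\<theta> 0\<close> below zero.\<close>
    show "\<theta> 0 = 0"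
      using surj[OF S2(2)] le[OF S1(2)] by (metis eqI mem S1(2) S2(2) zero_le)
    show "\<theta> id_blinfun = id_blinfun"
      using surj[OF S2(3)] le[OF _ S1(3)] by (metis eqI mem S1(3) S2(3) le_one)
    fix P Q assume PQ: "P \<in> \<S>\<^sub>1" "Q \<in> \<S>\<^sub>1"
    note inf1 = proj_le_compose_iff[OF d1(1)[OF PQ] d1(1)[OF PQ(2,1)] d1(2)[OF PQ]]
    note inf2 = proj_le_compose_iff[OF d2(1) d2(1) d2(2), OF mem mem mem mem mem mem,
        OF PQ(1,1) PQ(2,2) PQ]
    show "\<theta> (P o\<^sub>L Q) = \<theta> P o\<^sub>L \<theta> Q"
    proof (rule eqI)
      \<comment> \<open>Pulling the target meet back to \<open>R\<close> lets its lower-bound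
        property be compared with \<open>P o\<^sub>L Q\<close> inside
        \<open>\<S>\<^sub>1\<close>.\<close>
      obtain R where R: "R \<in> \<S>\<^sub>1" "\<theta> P o\<^sub>L \<theta> Q = \<theta> R"
        using surj d2(3)[OF mem mem, OF PQ] by blast
      show "proj_le (\<theta> (P o\<^sub>L Q)) (\<theta> P o\<^sub>L \<theta> Q)"
        using inf1[of "P o\<^sub>L Q"] by (simp add: inf2 le PQ d1(3) le_refl)
      have "proj_le R P \<and> proj_le R Q"
        using inf2[of "\<theta> R"] R PQ by (simp add: le le_refl)
      then show "proj_le (\<theta> P o\<^sub>L \<theta> Q) (\<theta> (P o\<^sub>L Q))"
        using R PQ by (simp add: le d1(3) inf1)
    qed (simp_all add: mem d1(3) d2(3) PQ)
    note sup1 = proj_join_le_iff[OF d1(1)[OF PQ] d1(1)[OF PQ(2,1)] d1(2)[OF PQ]]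
    note sup2 = proj_join_le_iff[OF d2(1) d2(1) d2(2), OF mem mem mem mem mem mem,
        OF PQ(1,1) PQ(2,2) PQ]
    show "\<theta> (proj_join P Q) = proj_join (\<theta> P) (\<theta> Q)"
    proof (rule eqI)
      obtain R where R: "R \<in> \<S>\<^sub>1" "proj_join (\<theta> P) (\<theta> Q) = \<theta> R"
        using surj d2(4)[OF mem mem, OF PQ] by blast
      have J: "proj_join P Q \<in> \<S>\<^sub>1"
        by (rule d1(4)[OF PQ])
      \<comment> \<open>The universal property of the join needs its upper bounds to be
        projections.\<close>
      have pr: "is_projection R" "is_projection (\<theta> R)" "is_projection (proj_join P Q)"
        "is_projection (\<theta> (proj_join P Q))"
        using d1(1)[OF R(1) R(1)] d2(1)[OF mem mem, OF R(1) R(1)] d1(1)[OF J J]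
          d2(1)[OF mem mem, OF J J] by auto
      show "proj_le (proj_join (\<theta> P) (\<theta> Q)) (\<theta> (proj_join P Q))"
        using sup1[OF pr(3)] by (simp add: sup2[OF pr(4)] le PQ J le_refl)
      have "proj_le P R \<and> proj_le Q R"
        using sup2[OF pr(2)] R PQ by (simp add: le le_refl)
      then show "proj_le (\<theta> (proj_join P Q)) (proj_join (\<theta> P) (\<theta> Q))"
        using R by (simp add: le J sup1[OF pr(1)])
    qed (simp_all add: mem d1(4) d2(4) PQ)
    show "is_projection P" "is_projection (\<theta> P)"
      using d1(1)[OF PQ(1,1)] d2(1)[OF mem mem, OF PQ(1,1)] by auto
    show "P o\<^sub>L Q = Q o\<^sub>L P" "P o\<^sub>L Q \<in> \<S>\<^sub>1" "proj_join P Q \<in> \<S>\<^sub>1"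
      using d1(2-4)[OF PQ] .
  next
    show "inj_on \<theta> \<S>\<^sub>1"
      using bij by (rule bij_betw_imp_inj_on)
  qed (rule S1)+
qed

theorem lemma5p1:
  fixes \<S>\<^sub>1 :: "('a::chilbert_space \<Rightarrow>\<^sub>L 'a) set"
    and \<S>\<^sub>2 :: "('b::chilbert_space \<Rightarrow>\<^sub>L 'b) set"
    and \<theta> :: "('a \<Rightarrow>\<^sub>L 'a) \<Rightarrow> ('b \<Rightarrow>\<^sub>L 'b)"
  assumes "separable_space (euclidean :: 'a topology)"
    and "separable_space (euclidean :: 'b topology)"
    and "commutative_projection_lattice \<S>\<^sub>1" "0 \<in> \<S>\<^sub>1" "id_blinfun \<in> \<S>\<^sub>1"
    and "commutative_projection_lattice \<S>\<^sub>2" "0 \<in> \<S>\<^sub>2" "id_blinfun \<in> \<S>\<^sub>2"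
    and "lattice_isomorphism \<S>\<^sub>1 \<S>\<^sub>2 \<theta>"
  shows "\<exists>\<rho>. star_isomorphism (closure (cspan \<S>\<^sub>1)) (closure (cspan \<S>\<^sub>2)) \<rho> \<and>
    (\<forall>P\<in>\<S>\<^sub>1. \<rho> P = \<theta> P)"
proof -
  interpret projection_embedding \<S>\<^sub>1 \<theta>
    using assms(3-) by (rule projection_embedding_if_lattice_isomorphism)
  have "\<theta> ` \<S>\<^sub>1 = \<S>\<^sub>2"
    using assms(9) by (simp add: lattice_isomorphism_def bij_betw_def)
  then show ?thesis
    using star_isomorphism_extension by simp
qed

end
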